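(* For every $n\in\mathbb{N}$, the graph $L\cup LK_{1,n}$ is not super edge-magic.
   Context: Graphs are finite and undirected, may contain loops, but multiple edges are not allowed. $\mathbb{N}$ denotes the positive integers, and for integers $m\le n$, $[m,n]=\{m,m+1,\dots,n\}$. $L$ is the loop graph: a single vertex with a loop. $LK_{1,n}$ is the graph obtained from the star $K_{1,n}$ (one central vertex joined to $n$ other vertices) by attaching a loop at its central vertex (for $n=1$: an edge with a loop at one of its two endpoints). $\cup$ denotes disjoint union of graphs. Let $G$ be a graph with $p$ vertices and $q$ edges (loops count as edges). $G$ is edge-magic if there is a bijection $f:V(G)\cup E(G)\to[1,p+q]$ and a constant $k$ such that $f(x)+f(xy)+f(y)=k$ for every edge $xy\in E(G)$ (for a loop, $x=y$). $G$ is super edge-magic if there is such an $f$ with, in addition, $f(V(G))=[1,p]$. It is known that, equivalently, $G$ is super edge-magic if and only if there is a bijection $g:V(G)\to[1,p]$ such that $\{g(u)+g(v):uv\in E(G)\}$ is a set of $q$ consecutive integers (a loop at $u$ contributes $2g(u)$). *)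

theory Defs
  imports Main
begin

text \<open>An edge is the set of its endpoints, so multiple edges are excluded and a loop at \<open>x\<close>
  is the edge \<open>{x, x} = {x}\<close>.\<close>

record 'a ugraph =
  verts :: "'a set"
  edges :: "'a set set"

definition is_graph :: "'a ugraph \<Rightarrow> bool" where
  "is_graph G \<longleftrightarrow>
     finite (verts G) \<and> (\<forall>e \<in> edges G. \<exists>x \<in> verts G. \<exists>y \<in> verts G. e = {x, y})"

definition loop_graph :: "unit ugraph" where
  "loop_graph = \<lparr>verts = {()}, edges = {{()}}\<rparr>"

definition star :: "nat \<Rightarrow> nat ugraph" where
  "star n = \<lparr>verts = {0..n}, edges = {{0, i} | i. i \<in> {1..n}}\<rparr>"

definition attach_loop :: "'a \<Rightarrow> 'a ugraph \<Rightarrow> 'a ugraph" where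
  "attach_loop x G = \<lparr>verts = verts G, edges = insert {x} (edges G)\<rparr>"

definition looped_star :: "nat \<Rightarrow> nat ugraph" where
  "looped_star n = attach_loop 0 (star n)"

definition disjoint_union :: "'a ugraph \<Rightarrow> 'b ugraph \<Rightarrow> ('a + 'b) ugraph" where
  "disjoint_union G H =
     \<lparr>verts = Inl ` verts G \<union> Inr ` verts H,
      edges = (image Inl) ` edges G \<union> (image Inr) ` edges H\<rparr>"

text \<open>A labelling of \<open>V(G) \<union> E(G)\<close> is a function on the disjoint sum \<open>verts G <+> edges G\<close>:
  \<open>f (Inl x)\<close> is the label of the vertex \<open>x\<close> and \<open>f (Inr {x, y})\<close> that of the edge \<open>xy\<close>.\<close>

definition edge_magic_labelling :: "'a ugraph \<Rightarrow> ('a + 'a set \<Rightarrow> nat) \<Rightarrow> bool" where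
  "edge_magic_labelling G f \<longleftrightarrow>
     bij_betw f (verts G <+> edges G) {1..card (verts G) + card (edges G)} \<and>
     (\<exists>k. \<forall>x y. {x, y} \<in> edges G \<longrightarrow> f (Inl x) + f (Inr {x, y}) + f (Inl y) = k)"

definition edge_magic :: "'a ugraph \<Rightarrow> bool" where
  "edge_magic G \<longleftrightarrow> (\<exists>f. edge_magic_labelling G f)"

definition super_edge_magic :: "'a ugraph \<Rightarrow> bool" where
  "super_edge_magic G \<longleftrightarrow>
     (\<exists>f. edge_magic_labelling G f \<and> f ` Inl ` verts G = {1..card (verts G)})"

lemma is_graph_loop_graph: "is_graph loop_graph"
  by (simp add: is_graph_def loop_graph_def)

lemma is_graph_star: "is_graph (star n)"
  by (fastforce simp: is_graph_def star_def)

lemma is_graph_attach_loop: "is_graph G \<Longrightarrow> x \<in> verts G \<Longrightarrow> is_graph (attach_loop x G)"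
  by (auto simp: is_graph_def attach_loop_def)

lemma is_graph_looped_star: "is_graph (looped_star n)"
  unfolding looped_star_def
  by (rule is_graph_attach_loop[OF is_graph_star]) (simp add: star_def)

lemma is_graph_disjoint_union:
  assumes "is_graph G" and "is_graph H"
  shows "is_graph (disjoint_union G H)"
  using assms unfolding is_graph_def disjoint_union_def by fastforce

end

theory Submission
  imports Defs
begin

text \<open>A super edge-magic labelling gives the edges the labels that follow those of the vertices, and
  the label of an edge and the sum of its end labels add up to a constant. So the edge sums form an
  interval (\<open>super_edge_magic_imp_consecutive_sums\<close>). If two vertices labelled \<open>a\<close> and \<open>c\<close>
  carry loops, then \<open>2a\<close> and \<open>2c\<close> are edge sums, hence so is their midpoint \<open>a + c\<close>
  (\<open>super_edge_magic_two_loops\<close>).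

  In \<open>L \<union> LK\<^sub>1\<^sub>,\<^sub>n\<close>, let \<open>a\<close> be the label of the isolated looped vertex and \<open>c\<close> that of the
  centre. The edge sums are \<open>2a\<close> and \<open>c + x\<close>, where \<open>x\<close> runs over all vertex labels other than
  \<open>a\<close>. As \<open>a \<noteq> c\<close>, none of them is \<open>a + c\<close>.\<close>

text \<open>With \<open>p\<close> vertices, \<open>q\<close> edges and magic constant \<open>k\<close>, the edge labels are exactly
  \<open>p + 1, \<dots>, p + q\<close>. The edge sums are their images under \<open>m \<mapsto> k - m\<close>, so the least sum is
  \<open>k - (p + q)\<close>.\<close>

lemma super_edge_magic_imp_consecutive_sums:
  assumes G: "is_graph G" and sem: "super_edge_magic G"
  obtains g :: "'a \<Rightarrow> nat" and s :: nat
  where "bij_betw g (verts G) {1..card (verts G)}"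
    and "{g x + g y | x y. {x, y} \<in> edges G} = {s..<s + card (edges G)}"
proof -
  let ?p = "card (verts G)" and ?q = "card (edges G)"
  obtain f k where bij: "bij_betw f (verts G <+> edges G) {1..?p + ?q}"
    and k: "\<And>x y. {x, y} \<in> edges G \<Longrightarrow> f (Inl x) + f (Inr {x, y}) + f (Inl y) = k"
    and fV: "f ` Inl ` verts G = {1..?p}"
    using sem unfolding super_edge_magic_def edge_magic_labelling_def by blast
  have inj: "inj_on f (Inl ` verts G \<union> Inr ` edges G)"
    and im: "f ` (Inl ` verts G \<union> Inr ` edges G) = {1..?p + ?q}"
    using bij by (simp_all add: bij_betw_def Plus_def)
  have "f ` Inl ` verts G \<inter> f ` Inr ` edges G = {}"
    using inj_on_image_Int[OF inj, of "Inl ` verts G" "Inr ` edges G"] by auto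
  then have "f ` Inr ` edges G = {1..?p + ?q} - {1..?p}"
    using im fV by (auto simp: image_Un)
  then have fE: "f ` Inr ` edges G = {?p + 1..?p + ?q}"
    by auto
  let ?g = "\<lambda>x. f (Inl x)"
  let ?S = "{?g x + ?g y | x y. {x, y} \<in> edges G}"
  have ends: "\<exists>x y. e = {x, y}" if "e \<in> edges G" for e
    using G that unfolding is_graph_def by blast
  have "?S = {k - (?p + ?q)..<k - (?p + ?q) + ?q}"
  proof (cases "?q = 0")
    case True
    then have "edges G = {}" using fE by auto
    then show ?thesis by simp
  next
    case False
    have sum_of_label: "\<exists>x y. {x, y} \<in> edges G \<and> ?g x + ?g y + m = k"
      if m: "m \<in> {?p + 1..?p + ?q}" for m
    proof -
      obtain e where e: "e \<in> edges G" "m = f (Inr e)" using m fE by blast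
      obtain x y where "e = {x, y}" using ends e(1) by blast
      then show ?thesis using k[of x y] e by (auto simp: ac_simps)
    qed
    \<comment> \<open>The largest label shows that the subtraction in the bound is not truncated.\<close>
    have kge: "?p + ?q \<le> k" using sum_of_label[of "?p + ?q"] False by auto
    show ?thesis
    proof (intro equalityI subsetI)
      fix t assume "t \<in> ?S"
      then obtain x y where xy: "{x, y} \<in> edges G" "t = ?g x + ?g y" by blast
      then have "f (Inr {x, y}) \<in> {?p + 1..?p + ?q}" using fE by blast
      then show "t \<in> {k - (?p + ?q)..<k - (?p + ?q) + ?q}"
        using k[OF xy(1)] xy(2) by auto
    next
      fix t assume t: "t \<in> {k - (?p + ?q)..<k - (?p + ?q) + ?q}"
      then have "k - t \<in> {?p + 1..?p + ?q}" "t \<le> k" using kge by auto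
      then show "t \<in> ?S" using sum_of_label[of "k - t"] by force
    qed
  qed
  moreover have "inj_on (f \<circ> Inl) (verts G)"
    by (intro comp_inj_on inj_on_subset[OF inj]) auto
  then have "bij_betw ?g (verts G) {1..?p}"
    using fV by (simp add: bij_betw_def image_image comp_def)
  ultimately show thesis using that by blast
qed

text \<open>Only the convexity of the set of edge sums is used: it contains \<open>2 g(u)\<close> and \<open>2 g(v)\<close>, and
  therefore the number halfway between them.\<close>

lemma super_edge_magic_two_loops:
  assumes "is_graph G" and "super_edge_magic G"
    and u: "{u} \<in> edges G" and v: "{v} \<in> edges G"
  obtains g :: "'a \<Rightarrow> nat" and x y
  where "inj_on g (verts G)" and "{x, y} \<in> edges G" and "g x + g y = g u + g v"
proof -
  obtain g s where bij: "bij_betw g (verts G) {1..card (verts G)}"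
    and S: "{g x + g y | x y. {x, y} \<in> edges G} = {s..<s + card (edges G)}"
    using super_edge_magic_imp_consecutive_sums[OF assms(1,2)] .
  have loop_sum: "g w + g w \<in> {s..<s + card (edges G)}" if "{w} \<in> edges G" for w
    unfolding S[symmetric] using that by (auto intro!: exI[of _ w])
  have "g u + g v \<in> {s..<s + card (edges G)}"
    using loop_sum[OF u] loop_sum[OF v] by auto
  then have "g u + g v \<in> {g x + g y | x y. {x, y} \<in> edges G}"
    unfolding S .
  then obtain x y where "{x, y} \<in> edges G" "g x + g y = g u + g v"
    by auto
  then show thesis using that bij by (auto simp: bij_betw_def)
qed

theorem theorem3p2:
  fixes n :: nat
  assumes "n \<ge> 1"
  shows "\<not> super_edge_magic (disjoint_union loop_graph (looped_star n))"
proof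
  let ?G = "disjoint_union loop_graph (looped_star n)"
  have V: "verts ?G = insert (Inl ()) (Inr ` {0..n})"
    by (simp add: disjoint_union_def loop_graph_def looped_star_def attach_loop_def star_def)
  \<comment> \<open>The loop at the centre is the case \<open>i = 0\<close> of \<open>{Inr 0, Inr i}\<close>.\<close>
  have E: "edges ?G = insert {Inl ()} ((\<lambda>i. {Inr 0, Inr i}) ` {0..n})"
  proof -
    have "{0..n} = insert 0 {1..n}" by auto
    then show ?thesis
      by (simp add: disjoint_union_def loop_graph_def looped_star_def attach_loop_def star_def
          setcompr_eq_image image_image insert_commute del: atLeastAtMost_iff)
  qed
  assume "super_edge_magic ?G"
  moreover have "is_graph ?G"
    by (intro is_graph_disjoint_union is_graph_loop_graph is_graph_looped_star)
  moreover have "{Inl ()} \<in> edges ?G" "{Inr 0} \<in> edges ?G"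
    unfolding E by auto
  ultimately obtain g :: "unit + nat \<Rightarrow> nat" and x y
    where inj: "inj_on g (verts ?G)" and xy: "{x, y} \<in> edges ?G"
    and eq: "g x + g y = g (Inl ()) + g (Inr 0)"
    using super_edge_magic_two_loops[of ?G "Inl ()" "Inr 0"] by blast
  have ne: "g (Inr i) \<noteq> g (Inl ())" if "i \<le> n" for i
    using inj that by (auto simp: V inj_on_def)
  from xy consider "x = Inl ()" "y = Inl ()"
    | i where "i \<le> n" "{x, y} = {Inr 0, Inr i}"
    unfolding E by auto
  then show False
  proof cases
    case 1
    then show False using eq ne[of 0] by simp
  next
    case 2
    then have "g x + g y = g (Inr 0) + g (Inr i)"
      by (auto simp: doubleton_eq_iff)
    then show False using eq ne[OF 2(1)] by simp
  qed
qed

end
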